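(* Let $(\mathbf{A},\mathbf{B})$ be a promise template over finite domains. The following are equivalent: (i) the BLP+Affine algorithm correctly solves $\operatorname{PCSP-Decision}(\mathbf{A},\mathbf{B})$; (ii) $\operatorname{Pol}(\mathbf{A},\mathbf{B})$ contains block-symmetric polymorphisms of arbitrarily high width; (iii) for every $L\in\mathbb{N}$, $\operatorname{Pol}(\mathbf{A},\mathbf{B})$ contains a block-symmetric polymorphism of arity $2L+1$ with two symmetric blocks of coordinates of sizes $L$ and $L+1$ respectively.
   Context: A signature $\tau$ is a set of symbols $R$, each with a positive integer arity $\operatorname{ar}(R)$. A relational structure $\mathbf{A}$ with signature $\tau$ consists of a finite domain $A$ and relations $R^{\mathbf{A}}\subseteq A^{\operatorname{ar}(R)}$ for $R\in\tau$. A homomorphism $\mathbf{A}\to\mathbf{B}$ is a map $\sigma:A\to B$ with $\sigma(R^{\mathbf{A}})\subseteq R^{\mathbf{B}}$ for all $R\in\tau$ (componentwise). A promise template $(\mathbf{A},\mathbf{B})$ is a pair of such structures with the same signature such that a homomorphism $\mathbf{A}\to\mathbf{B}$ exists. An instance $\mathbf{X}$ consists of variables $x_1,\dots,x_n$ and constraints $c_j=(R_j,\bar x^j)$, $j\in[m]$, with $R_j\in\tau$ and $\bar x^j$ a tuple of variables of length $\operatorname{ar}(R_j)$. $\mathbf{X}$ is satisfiable in $\mathbf{C}$ if some assignment $\sigma$ of values in $C$ to variables has $\sigma(\bar x^j)\in R_j^{\mathbf{C}}$ for all $j$. $\operatorname{PCSP-Decision}(\mathbf{A},\mathbf{B})$: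 distinguish instances satisfiable in $\mathbf{A}$ from instances not satisfiable in $\mathbf{B}$. A polymorphism of $(\mathbf{A},\mathbf{B})$ of arity $L$ is a map $f:A^L\to B$ such that for every $R\in\tau$ and all $x^{(1)},\dots,x^{(L)}\in R^{\mathbf{A}}$, the tuple $(f(x^{(1)}_t,\dots,x^{(L)}_t))_{t=1}^{\operatorname{ar}(R)}$ lies in $R^{\mathbf{B}}$. $\operatorname{Pol}(\mathbf{A},\mathbf{B})$ is the set of all polymorphisms. $f:A^L\to B$ is block-symmetric with respect to a partition $[L]=B_1\cup\dots\cup B_k$ (its blocks) if $f$ is invariant under every permutation of coordinates mapping each block to itself. The width of $f$ is the maximum, over all partitions with respect to which $f$ is block-symmetric, of the minimum block size; "arbitrarily high width" means for every $N$ some polymorphism has width at least $N$. Basic LP $\operatorname{LP}_{\mathbb{Q}}(\mathbf{X},\mathbf{A})$: rational variables $w_i(a)$ ($i\in[n],a\in A$), $p_j(y)$ ($j\in[m]$, $y\in R_j^{\mathbf{A}}$) with $w_i(a)\ge0$, $p_j(y)\ge0$, $\sum_a w_i(a)=1$, $\sum_{y}p_j(y)=1$, and $\sum_{y\in R_j^{\mathbf{A}},\,y|_i=a}p_j(y)=w_i(a)$ for all $i,a,j$ with $x_i$ occurring in $\bar x^j$ ($y|_i=a$ meaning the coordinate of $y$ at the position of $x_i$ in $\bar x^j$ is $a$). Affine relaxation $\operatorname{Aff}_{\mathbb{Z}}(\mathbf{X},\mathbf{A})$: integer variables $r_i(a)$, $q_j(y)$ satisfying the same equalities (no nonnegativity).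 BLP+Affine algorithm: (1) If $\operatorname{LP}_{\mathbb{Q}}(\mathbf{X},\mathbf{A})$ is infeasible, reject; otherwise take a relative interior point $(w,p)$ (a feasible point where each coordinate is positive iff it is positive at some feasible point). (2) Form $\operatorname{Aff}'_{\mathbb{Z}}(\mathbf{X},\mathbf{A})$ by adding to $\operatorname{Aff}_{\mathbb{Z}}(\mathbf{X},\mathbf{A})$ the constraints $r_i(a)=0$ whenever $w_i(a)=0$ and $q_j(y)=0$ whenever $p_j(y)=0$. (3) If $\operatorname{Aff}'_{\mathbb{Z}}(\mathbf{X},\mathbf{A})$ has no integer solution, reject; else accept. It correctly solves $\operatorname{PCSP-Decision}(\mathbf{A},\mathbf{B})$ if it accepts every instance satisfiable in $\mathbf{A}$ and rejects every instance not satisfiable in $\mathbf{B}$. *)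

theory Defs
  imports Complex_Main "HOL-Library.Disjoint_Sets" "HOL-Combinatorics.Permutations"
begin

section \<open>Relational structures and promise templates\<close>

record 's signature =
  symbols :: "'s set"
  arity :: "'s \<Rightarrow> nat"

definition signature :: "'s signature \<Rightarrow> bool" where
  "signature S \<longleftrightarrow> (\<forall>R\<in>symbols S. 0 < arity S R)"

text \<open>Tuples are lists; \<open>tuples U k\<close> is the power \<open>U\<^sup>k\<close>.\<close>

definition tuples :: "'a set \<Rightarrow> nat \<Rightarrow> 'a list set" where
  "tuples U k = {xs. length xs = k \<and> set xs \<subseteq> U}"

record ('s, 'a) rel_struct =
  universe :: "'a set"
  rel :: "'s \<Rightarrow> 'a list set"

definition rel_structure :: "'s signature \<Rightarrow> ('s, 'a) rel_struct \<Rightarrow> bool" where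
  "rel_structure S A \<longleftrightarrow>
     finite (universe A) \<and> (\<forall>R\<in>symbols S. rel A R \<subseteq> tuples (universe A) (arity S R))"

definition homomorphism ::
  "'s signature \<Rightarrow> ('s, 'a) rel_struct \<Rightarrow> ('s, 'b) rel_struct \<Rightarrow> ('a \<Rightarrow> 'b) \<Rightarrow> bool" where
  "homomorphism S A B h \<longleftrightarrow>
     (\<forall>a\<in>universe A. h a \<in> universe B) \<and> (\<forall>R\<in>symbols S. map h ` rel A R \<subseteq> rel B R)"

definition promise_template ::
  "'s signature \<Rightarrow> ('s, 'a) rel_struct \<Rightarrow> ('s, 'b) rel_struct \<Rightarrow> bool" where
  "promise_template S A B \<longleftrightarrow>
     signature S \<and> rel_structure S A \<and> rel_structure S B \<and> (\<exists>h. homomorphism S A B h)"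


section \<open>Instances\<close>

text \<open>The variables of an instance are \<open>0, \<dots>, num_vars X - 1\<close>. A variable may occur
  several times in the scope of a constraint.\<close>

record 's pcsp_inst =
  num_vars :: nat
  constraints :: "('s \<times> nat list) list"

abbreviation num_cons :: "'s pcsp_inst \<Rightarrow> nat" where
  "num_cons X \<equiv> length (constraints X)"

abbreviation con_sym :: "'s pcsp_inst \<Rightarrow> nat \<Rightarrow> 's" where
  "con_sym X j \<equiv> fst (constraints X ! j)"

abbreviation con_scope :: "'s pcsp_inst \<Rightarrow> nat \<Rightarrow> nat list" where
  "con_scope X j \<equiv> snd (constraints X ! j)"

definition pcsp_instance :: "'s signature \<Rightarrow> 's pcsp_inst \<Rightarrow> bool" where
  "pcsp_instance S X \<longleftrightarrow>
     (\<forall>j<num_cons X. con_sym X j \<in> symbols S \<and>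
        con_scope X j \<in> tuples {..<num_vars X} (arity S (con_sym X j)))"

definition satisfiable :: "'s pcsp_inst \<Rightarrow> ('s, 'c) rel_struct \<Rightarrow> bool" where
  "satisfiable X C \<longleftrightarrow>
     (\<exists>\<sigma>. (\<forall>i<num_vars X. \<sigma> i \<in> universe C) \<and>
          (\<forall>j<num_cons X. map \<sigma> (con_scope X j) \<in> rel C (con_sym X j)))"


section \<open>Polymorphisms\<close>

text \<open>An \<open>L\<close>-ary operation from \<open>A\<close> to \<open>B\<close> is a function on lists, of which only the values
  on lists in \<open>tuples (universe A) L\<close> matter. The list \<open>xss\<close> holds the \<open>L\<close> tuples
  \<open>x\<^sup>(1\<^sup>), \<dots>, x\<^sup>(L\<^sup>)\<close> of the relation, and \<open>map (\<lambda>x. x ! t) xss\<close> is the list of their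
  \<open>t\<close>-th coordinates. Arities are positive; a nullary operation, whose only partition
  has no blocks, would have no width.\<close>

definition Pol ::
  "'s signature \<Rightarrow> ('s, 'a) rel_struct \<Rightarrow> ('s, 'b) rel_struct \<Rightarrow> nat \<Rightarrow> ('a list \<Rightarrow> 'b) set" where
  "Pol S A B L = {f. 0 < L \<and> (\<forall>x\<in>tuples (universe A) L. f x \<in> universe B) \<and>
     (\<forall>R\<in>symbols S. \<forall>xss\<in>tuples (rel A R) L.
        map (\<lambda>t. f (map (\<lambda>x. x ! t) xss)) [0..<arity S R] \<in> rel B R)}"

definition block_symmetric :: "'a set \<Rightarrow> nat \<Rightarrow> ('a list \<Rightarrow> 'b) \<Rightarrow> nat set set \<Rightarrow> bool" where
  "block_symmetric U L f P \<longleftrightarrow>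
     (\<forall>\<pi>. \<pi> permutes {..<L} \<and> (\<forall>K\<in>P. \<pi> ` K = K) \<longrightarrow>
        (\<forall>x\<in>tuples U L. f (permute_list \<pi> x) = f x))"

definition width :: "'a set \<Rightarrow> nat \<Rightarrow> ('a list \<Rightarrow> 'b) \<Rightarrow> nat" where
  "width U L f =
     Max {Min (card ` P) | P. partition_on {..<L} P \<and> block_symmetric U L f P}"


section \<open>Basic LP, affine relaxation and the combined algorithm\<close>

text \<open>The equalities common to the two relaxations. The marginal condition is imposed at
  every position \<open>t\<close> of every constraint; in particular, at each of the positions
  of a repeated variable.\<close>

definition relaxation_eqs ::
  "'s pcsp_inst \<Rightarrow> ('s, 'a) rel_struct \<Rightarrow>
   (nat \<Rightarrow> 'a \<Rightarrow> 'n::comm_ring_1) \<Rightarrow> (nat \<Rightarrow> 'a list \<Rightarrow> 'n) \<Rightarrow> bool" where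
  "relaxation_eqs X A w p \<longleftrightarrow>
     (\<forall>i<num_vars X. (\<Sum>a\<in>universe A. w i a) = 1) \<and>
     (\<forall>j<num_cons X. (\<Sum>y\<in>rel A (con_sym X j). p j y) = 1) \<and>
     (\<forall>j<num_cons X. \<forall>t<length (con_scope X j). \<forall>a\<in>universe A.
        (\<Sum>y | y \<in> rel A (con_sym X j) \<and> y ! t = a. p j y) = w (con_scope X j ! t) a)"

definition basic_lp ::
  "'s pcsp_inst \<Rightarrow> ('s, 'a) rel_struct \<Rightarrow>
   (nat \<Rightarrow> 'a \<Rightarrow> rat) \<Rightarrow> (nat \<Rightarrow> 'a list \<Rightarrow> rat) \<Rightarrow> bool" where
  "basic_lp X A w p \<longleftrightarrow>
     relaxation_eqs X A w p \<and>
     (\<forall>i<num_vars X. \<forall>a\<in>universe A. 0 \<le> w i a) \<and>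
     (\<forall>j<num_cons X. \<forall>y\<in>rel A (con_sym X j). 0 \<le> p j y)"

definition basic_lp_interior ::
  "'s pcsp_inst \<Rightarrow> ('s, 'a) rel_struct \<Rightarrow>
   (nat \<Rightarrow> 'a \<Rightarrow> rat) \<Rightarrow> (nat \<Rightarrow> 'a list \<Rightarrow> rat) \<Rightarrow> bool" where
  "basic_lp_interior X A w p \<longleftrightarrow>
     basic_lp X A w p \<and>
     (\<forall>i<num_vars X. \<forall>a\<in>universe A.
        0 < w i a \<longleftrightarrow> (\<exists>w' p'. basic_lp X A w' p' \<and> 0 < w' i a)) \<and>
     (\<forall>j<num_cons X. \<forall>y\<in>rel A (con_sym X j).
        0 < p j y \<longleftrightarrow> (\<exists>w' p'. basic_lp X A w' p' \<and> 0 < p' j y))"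

definition aff_refined ::
  "'s pcsp_inst \<Rightarrow> ('s, 'a) rel_struct \<Rightarrow>
   (nat \<Rightarrow> 'a \<Rightarrow> rat) \<Rightarrow> (nat \<Rightarrow> 'a list \<Rightarrow> rat) \<Rightarrow>
   (nat \<Rightarrow> 'a \<Rightarrow> int) \<Rightarrow> (nat \<Rightarrow> 'a list \<Rightarrow> int) \<Rightarrow> bool" where
  "aff_refined X A w p r q \<longleftrightarrow>
     relaxation_eqs X A r q \<and>
     (\<forall>i<num_vars X. \<forall>a\<in>universe A. w i a = 0 \<longrightarrow> r i a = 0) \<and>
     (\<forall>j<num_cons X. \<forall>y\<in>rel A (con_sym X j). p j y = 0 \<longrightarrow> q j y = 0)"

text \<open>All relative interior points have the same support, hence lead to the same refined
  affine system (lemma \<open>aff_refined_interior_unique\<close>): the outcome does not depend on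
  the point that is taken. If the LP is infeasible there is no such point and the
  instance is rejected.\<close>

definition blp_affine_accepts :: "'s pcsp_inst \<Rightarrow> ('s, 'a) rel_struct \<Rightarrow> bool" where
  "blp_affine_accepts X A \<longleftrightarrow>
     (\<exists>w p. basic_lp_interior X A w p \<and> (\<exists>r q. aff_refined X A w p r q))"

lemma aff_refined_interior_unique:
  assumes "basic_lp_interior X A w p" "basic_lp_interior X A w' p'"
  shows "aff_refined X A w p r q \<longleftrightarrow> aff_refined X A w' p' r q"
proof -
  have w: "w i a = 0 \<longleftrightarrow> w' i a = 0" if "i < num_vars X" "a \<in> universe A" for i a
  proof -
    have "0 < w i a \<longleftrightarrow> 0 < w' i a"
      using assms that by (simp add: basic_lp_interior_def)
    moreover have "0 \<le> w i a" "0 \<le> w' i a"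
      using assms[unfolded basic_lp_interior_def] that by (simp_all add: basic_lp_def)
    ultimately show ?thesis by linarith
  qed
  have p: "p j y = 0 \<longleftrightarrow> p' j y = 0" if "j < num_cons X" "y \<in> rel A (con_sym X j)" for j y
  proof -
    have "0 < p j y \<longleftrightarrow> 0 < p' j y"
      using assms that by (simp add: basic_lp_interior_def)
    moreover have "0 \<le> p j y" "0 \<le> p' j y"
      using assms[unfolded basic_lp_interior_def] that by (simp_all add: basic_lp_def)
    ultimately show ?thesis by linarith
  qed
  show ?thesis
    using w p by (simp add: aff_refined_def)
qed

definition blp_affine_solves ::
  "'s signature \<Rightarrow> ('s, 'a) rel_struct \<Rightarrow> ('s, 'b) rel_struct \<Rightarrow> bool" where
  "blp_affine_solves S A B \<longleftrightarrow>
     (\<forall>X. pcsp_instance S X \<longrightarrow>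
        (satisfiable X A \<longrightarrow> blp_affine_accepts X A) \<and>
        (\<not> satisfiable X B \<longrightarrow> \<not> blp_affine_accepts X A))"

end

theory Submission
  imports Defs
begin

text \<open>A tuple is determined up to permutations within blocks by how often each value occurs in
  each block.

  If the algorithm is correct, it is run on the instance whose variables are the orbits of
  \<open>A\<^bsup>2L+1\<^esup>\<close> under the permutations preserving two blocks of sizes \<open>L\<close> and \<open>L + 1\<close>: averaging over
  all coordinates solves the LP, and adding up the coordinates with sign \<open>-1\<close> on the small block
  and \<open>+1\<close> on the large one solves the affine system within the same support. An assignment in \<open>B\<close> is then
  a block-symmetric polymorphism.

  Conversely, let \<open>D\<close> be a common denominator of an LP solution \<open>w\<close> and let \<open>r\<close> be an affine
  solution with smaller support. For every large \<open>b = D k + e\<close>, \<open>e < D\<close>, the integers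
  \<open>k D w + e r\<close> are nonnegative and have total \<open>b\<close>. Using them as numbers of occurrences in a block
  of size \<open>b\<close>, for every block, gives tuples at which a block-symmetric polymorphism of high
  width takes the values of a satisfying assignment.\<close>

section \<open>Tuples up to block-preserving permutations\<close>

text \<open>Here \<open>g l\<close> names the block of position \<open>l\<close>. Among tuples of a
  fixed length this multiset is a complete invariant of the orbit under the permutations preserving
  \<open>g\<close>, so it serves as a name for the orbit.\<close>

definition labelled_mset :: "(nat \<Rightarrow> 'c) \<Rightarrow> 'a list \<Rightarrow> ('c \<times> 'a) multiset" where
  "labelled_mset g x = image_mset (\<lambda>l. (g l, x ! l)) (mset_set {..<length x})"

lemma labelled_mset_permute_list:
  assumes "\<pi> permutes {..<length x}" "\<And>l. l < length x \<Longrightarrow> g (\<pi> l) = g l"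
  shows "labelled_mset g (permute_list \<pi> x) = labelled_mset g x"
proof -
  have "labelled_mset g (permute_list \<pi> x)
      = image_mset (\<lambda>l. (g (\<pi> l), x ! \<pi> l)) (mset_set {..<length x})"
    unfolding labelled_mset_def
    by (auto intro!: image_mset_cong simp: permute_list_nth[OF assms(1)] assms(2))
  also have "\<dots> = image_mset (\<lambda>l. (g l, x ! l)) (image_mset \<pi> (mset_set {..<length x}))"
    by (simp add: image_mset.compositionality comp_def)
  finally show ?thesis
    by (simp add: permutes_image_mset[OF assms(1)] labelled_mset_def)
qed

text \<open>Two maps on a finite set with equal image multisets differ by a permutation of that set.
  As the label is a component of the value, this permutation preserves labels.\<close>

lemma labelled_mset_eq_imp_permute_list:
  assumes "length x = length y" "labelled_mset g x = labelled_mset g y"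
  obtains \<pi> where "\<pi> permutes {..<length y}" "\<And>l. l < length y \<Longrightarrow> g (\<pi> l) = g l"
    "x = permute_list \<pi> y"
proof -
  obtain \<pi> where \<pi>: "\<pi> permutes {..<length y}"
    "\<forall>l\<in>{..<length y}. (g l, x ! l) = (g (\<pi> l), y ! \<pi> l)"
    using image_mset_eq_implies_permutes[of "{..<length y}" "\<lambda>l. (g l, x ! l)" "\<lambda>l. (g l, y ! l)"]
      assms by (auto simp: labelled_mset_def)
  moreover have "x = permute_list \<pi> y"
    using \<pi> assms(1) by (auto intro!: nth_equalityI simp: permute_list_nth)
  ultimately show thesis
    using that by auto
qed

lemma labelled_mset_eqI:
  fixes x y :: "'a list" and g :: "nat \<Rightarrow> 'c"
  assumes "length x = length y"
    and "\<And>b a. card {l \<in> {..<length y}. g l = b \<and> x ! l = a}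
                = card {l \<in> {..<length y}. g l = b \<and> y ! l = a}"
  shows "labelled_mset g x = labelled_mset g y"
proof (rule multiset_eqI)
  have c: "count (labelled_mset g z) (b, a) = card {l \<in> {..<length z}. g l = b \<and> z ! l = a}"
    for z :: "'a list" and b a
  proof -
    have "(\<lambda>l. (g l, z ! l)) -` {(b, a)} \<inter> {..<length z} = {l \<in> {..<length z}. g l = b \<and> z ! l = a}"
      by auto
    then show ?thesis
      by (simp add: labelled_mset_def count_image_mset)
  qed
  show "count (labelled_mset g x) ba = count (labelled_mset g y) ba" for ba
    using assms by (cases ba) (simp add: c)
qed

text \<open>With weights constant on blocks, a weighted count depends only on the orbit. A tuple may
  thus be replaced by another representative of its orbit in the marginal equations.\<close>

lemma sum_labelled_mset:
  fixes c :: "'c \<Rightarrow> 'n::comm_ring_1"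
  shows "(\<Sum>l<length x. c (g l) * of_bool (x ! l = a))
    = (\<Sum>(b, u)\<in>#labelled_mset g x. c b * of_bool (u = a))"
  by (simp add: labelled_mset_def sum_unfold_sum_mset image_mset.compositionality comp_def)

lemma tuples_nth: "x \<in> tuples U n \<Longrightarrow> l < n \<Longrightarrow> x ! l \<in> U"
  using nth_mem by (auto simp: tuples_def)

lemma finite_tuples: "finite U \<Longrightarrow> finite (tuples U n)"
  using finite_lists_length_eq[of U n] by (simp add: tuples_def conj_commute)

lemma rel_structureD:
  assumes "rel_structure S A"
  shows "finite (universe A)"
    and "R \<in> symbols S \<Longrightarrow> finite (rel A R)"
    and "R \<in> symbols S \<Longrightarrow> y \<in> rel A R \<Longrightarrow> y \<in> tuples (universe A) (arity S R)"
  using assms finite_tuples[of "universe A" "arity S R"]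
  by (auto simp: rel_structure_def intro: finite_subset)

lemma column_in_tuples:
  assumes "rel_structure S A" "R \<in> symbols S" "xss \<in> tuples (rel A R) n" "t < arity S R"
  shows "map (\<lambda>y. y ! t) xss \<in> tuples (universe A) n"
proof -
  have "y ! t \<in> universe A" if "y \<in> set xss" for y
  proof -
    have "y \<in> tuples (universe A) (arity S R)"
      using that assms rel_structureD(3) by (fastforce simp: tuples_def)
    then show ?thesis
      using assms(4) by (rule tuples_nth)
  qed
  then show ?thesis
    using assms(3) by (auto simp: tuples_def)
qed


section \<open>Acceptance\<close>

lemma relaxation_eqs_average:
  assumes "relaxation_eqs X A w p" "relaxation_eqs X A w' p'"
  shows "relaxation_eqs X A (\<lambda>i a. (w i a + w' i a) / (2::rat)) (\<lambda>j y. (p j y + p' j y) / 2)"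
  using assms by (simp add: relaxation_eqs_def flip: sum_divide_distrib add: sum.distrib)

lemma basic_lp_average:
  assumes "basic_lp X A w p" "basic_lp X A w' p'"
  shows "basic_lp X A (\<lambda>i a. (w i a + w' i a) / 2) (\<lambda>j y. (p j y + p' j y) / 2)"
  using assms relaxation_eqs_average[of X A w p w' p'] unfolding basic_lp_def by auto

text \<open>A feasible point of maximal support is a relative interior point, since the support of
  the average of two feasible points is the union of their supports.\<close>

lemma basic_lp_interior_exists:
  fixes X :: "'s pcsp_inst" and A :: "('s, 'a) rel_struct"
  assumes fin: "finite (universe A)" "\<And>j. j < num_cons X \<Longrightarrow> finite (rel A (con_sym X j))"
    and "basic_lp X A w0 p0"
  obtains w p where "basic_lp_interior X A w p"
proof -
  define I where "I = {..<num_vars X} \<times> universe A"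
  define J where "J = (SIGMA j:{..<num_cons X}. rel A (con_sym X j))"
  define supp :: "(nat \<Rightarrow> 'a \<Rightarrow> rat) \<times> (nat \<Rightarrow> 'a list \<Rightarrow> rat) \<Rightarrow> _" where
    "supp = (\<lambda>(w, p). {(i, a) \<in> I. 0 < w i a} <+> {(j, y) \<in> J. 0 < p j y})"
  have finIJ: "finite (I <+> J)"
    using fin by (auto simp: I_def J_def)
  \<comment> \<open>All supports lie in one finite set, so their sizes are bounded and a largest one
    exists.\<close>
  have supp_sub: "supp wp \<subseteq> I <+> J" for wp
    by (auto simp: supp_def split: prod.splits)
  then have "card (supp wp) < Suc (card (I <+> J))" for wp
    using card_mono[OF finIJ supp_sub] by (simp add: less_Suc_eq_le)
  then obtain wp where wp: "(\<lambda>(w, p). basic_lp X A w p) wp"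
    and max: "\<And>wp'. (\<lambda>(w, p). basic_lp X A w p) wp' \<Longrightarrow> card (supp wp') \<le> card (supp wp)"
    using ex_has_greatest_nat[of "\<lambda>(w, p). basic_lp X A w p" "(w0, p0)" "\<lambda>wp. card (supp wp)"
      "Suc (card (I <+> J))"] assms(3) by (auto simp: less_imp_le)
  obtain w p where wp_eq: "wp = (w, p)"
    by (cases wp)
  have lp: "basic_lp X A w p"
    using wp by (simp add: wp_eq)
  have sub: "supp (w', p') \<subseteq> supp (w, p)" if lp': "basic_lp X A w' p'" for w' p'
  proof -
    let ?v = "(\<lambda>i a. (w i a + w' i a) / 2, \<lambda>j y. (p j y + p' j y) / 2)"
    have nonneg: "0 \<le> w i a" "0 \<le> w' i a" if "(i, a) \<in> I" for i a
      using that lp lp' by (auto simp: I_def basic_lp_def)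
    have nonneg': "0 \<le> p j y" "0 \<le> p' j y" if "(j, y) \<in> J" for j y
      using that lp lp' by (auto simp: J_def basic_lp_def)
    have 1: "supp (w, p) \<subseteq> supp ?v" and 2: "supp (w', p') \<subseteq> supp ?v"
      using nonneg nonneg' by (fastforce simp: supp_def intro: add_pos_nonneg add_nonneg_pos)+
    have "card (supp ?v) \<le> card (supp (w, p))"
      using max[of ?v] basic_lp_average[OF lp lp'] by (simp add: wp_eq)
    then have "supp (w, p) = supp ?v"
      using 1 finite_subset[OF supp_sub finIJ] by (meson card_seteq)
    with 2 show ?thesis
      by simp
  qed
  have "basic_lp_interior X A w p"
    unfolding basic_lp_interior_def
  proof (intro conjI allI impI ballI iffI)
    fix i a
    assume "i < num_vars X" "a \<in> universe A"
      and "\<exists>w' p'. basic_lp X A w' p' \<and> 0 < w' i a"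
    then obtain w' p' where "basic_lp X A w' p'" "Inl (i, a) \<in> supp (w', p')"
      by (auto simp: supp_def I_def)
    then have "Inl (i, a) \<in> supp (w, p)"
      using sub by blast
    then show "0 < w i a"
      by (auto simp: supp_def)
  next
    fix j y
    assume "j < num_cons X" "y \<in> rel A (con_sym X j)"
      and "\<exists>w' p'. basic_lp X A w' p' \<and> 0 < p' j y"
    then obtain w' p' where "basic_lp X A w' p'" "Inr (j, y) \<in> supp (w', p')"
      by (auto simp: supp_def J_def)
    then have "Inr (j, y) \<in> supp (w, p)"
      using sub by blast
    then show "0 < p j y"
      by (auto simp: supp_def)
  qed (use lp in auto)
  then show thesis
    by (rule that)
qed

text \<open>An interior point has the largest support of all feasible points, so an integer solution
  vanishing wherever \<open>w\<close> does also vanishes wherever the interior point does. Any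
  feasible point can therefore certify acceptance.\<close>

lemma blp_affine_acceptsI:
  assumes "finite (universe A)" "\<And>j. j < num_cons X \<Longrightarrow> finite (rel A (con_sym X j))"
    and lp: "basic_lp X A w p" and aff: "aff_refined X A w p r q"
  shows "blp_affine_accepts X A"
proof -
  obtain w' p' where int: "basic_lp_interior X A w' p'"
    using basic_lp_interior_exists[OF assms(1-3)] by blast
  have "w i a = 0" if "i < num_vars X" "a \<in> universe A" "w' i a = 0" for i a
  proof -
    have "\<not> 0 < w i a"
      using int lp that unfolding basic_lp_interior_def by (metis less_irrefl)
    then show ?thesis
      using lp that by (force simp: basic_lp_def)
  qed
  moreover have "p j y = 0" if "j < num_cons X" "y \<in> rel A (con_sym X j)" "p' j y = 0" for j y
  proof -
    have "\<not> 0 < p j y"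
      using int lp that unfolding basic_lp_interior_def by (metis less_irrefl)
    then show ?thesis
      using lp that by (force simp: basic_lp_def)
  qed
  ultimately have "aff_refined X A w' p' r q"
    using aff by (simp add: aff_refined_def)
  then show ?thesis
    using int by (auto simp: blp_affine_accepts_def)
qed

section \<open>Solutions of both relaxations from columns of tuples\<close>

lemma sum_of_bool_swap:
  fixes c :: "nat \<Rightarrow> 'n::comm_ring_1"
  assumes "finite Y"
  shows "(\<Sum>y\<in>Y. \<Sum>l<n. c l * of_bool (z l = y)) = (\<Sum>l<n. c l * of_bool (z l \<in> Y))"
proof -
  have "(\<Sum>y\<in>Y. c l * of_bool (z l = y)) = c l * of_bool (z l \<in> Y)" for l
    using assms by (simp add: of_bool_def if_distrib[of "(*) (c l)"] sum.delta' cong: if_cong)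
  then show ?thesis
    by (subst sum.swap) simp
qed

text \<open>Each coordinate contributes indicator functions of total 1, and the weights sum to 1. A
  column of \<open>xss j\<close> need only lie in the orbit of the tuple of its variable: the
  weights depend only on the block, so the marginals still agree. The ring is general in order to
  cover rational and integer weights alike.\<close>

lemma relaxation_eqs_columns:
  fixes c :: "'c \<Rightarrow> 'n::comm_ring_1"
  assumes finA: "finite (universe A)" and finR: "\<And>j. j < num_cons X \<Longrightarrow> finite (rel A (con_sym X j))"
    and c: "(\<Sum>l<n. c (g l)) = 1"
    and x: "\<And>i. i < num_vars X \<Longrightarrow> x i \<in> tuples (universe A) n"
    and xss: "\<And>j. j < num_cons X \<Longrightarrow> xss j \<in> tuples (rel A (con_sym X j)) n"
    and col: "\<And>j t. j < num_cons X \<Longrightarrow> t < length (con_scope X j) \<Longrightarrow>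
        con_scope X j ! t < num_vars X \<and>
        labelled_mset g (map (\<lambda>y. y ! t) (xss j)) = labelled_mset g (x (con_scope X j ! t))"
  shows "relaxation_eqs X A (\<lambda>i a. \<Sum>l<n. c (g l) * of_bool (x i ! l = a))
           (\<lambda>j y. \<Sum>l<n. c (g l) * of_bool (xss j ! l = y))"
  unfolding relaxation_eqs_def
proof (intro conjI allI impI ballI)
  have total: "(\<Sum>y\<in>Y. \<Sum>l<n. c (g l) * of_bool (z ! l = y)) = 1"
    if "finite Y" "z \<in> tuples Y n" for Y :: "'z set" and z
  proof -
    have "(\<Sum>y\<in>Y. \<Sum>l<n. c (g l) * of_bool (z ! l = y)) = (\<Sum>l<n. c (g l) * of_bool (z ! l \<in> Y))"
      using that(1) by (rule sum_of_bool_swap)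
    also have "\<dots> = (\<Sum>l<n. c (g l))"
      using tuples_nth[OF that(2)] by (intro sum.cong) auto
    finally show ?thesis
      using c by simp
  qed
  show "(\<Sum>a\<in>universe A. \<Sum>l<n. c (g l) * of_bool (x i ! l = a)) = 1" if "i < num_vars X" for i
    using total finA x that by blast
  show "(\<Sum>y\<in>rel A (con_sym X j). \<Sum>l<n. c (g l) * of_bool (xss j ! l = y)) = 1"
    if "j < num_cons X" for j
    using total finR xss that by blast
  fix j t a
  assume jt: "j < num_cons X" "t < length (con_scope X j)"
  let ?i = "con_scope X j ! t"
  have len: "length (xss j) = n" "length (x ?i) = n"
    using x xss col jt by (auto simp: tuples_def)
  have "(\<Sum>y | y \<in> rel A (con_sym X j) \<and> y ! t = a. \<Sum>l<n. c (g l) * of_bool (xss j ! l = y))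
      = (\<Sum>l<n. c (g l) * of_bool (xss j ! l \<in> {y \<in> rel A (con_sym X j). y ! t = a}))"
    using finR[OF jt(1)] by (intro sum_of_bool_swap) simp
  also have "\<dots> = (\<Sum>l<n. c (g l) * of_bool (map (\<lambda>y. y ! t) (xss j) ! l = a))"
    using tuples_nth[OF xss[OF jt(1)]] len by (intro sum.cong) auto
  also have "\<dots> = (\<Sum>l<n. c (g l) * of_bool (x ?i ! l = a))"
    using sum_labelled_mset[of c g "map (\<lambda>y. y ! t) (xss j)" a] sum_labelled_mset[of c g "x ?i" a]
      col[OF jt] len by simp
  finally show "(\<Sum>y | y \<in> rel A (con_sym X j) \<and> y ! t = a.
      \<Sum>l<n. c (g l) * of_bool (xss j ! l = y)) = (\<Sum>l<n. c (g l) * of_bool (x ?i ! l = a))" .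
qed

text \<open>Uniform weights \<open>1 / n\<close> solve the LP and are positive at everything that
  occurs in some coordinate. The weights \<open>c\<close>, possibly negative, give an integer
  solution supported on what occurs.\<close>

lemma blp_affine_accepts_columns:
  fixes c :: "'c \<Rightarrow> int"
  assumes fin: "finite (universe A)" "\<And>j. j < num_cons X \<Longrightarrow> finite (rel A (con_sym X j))"
    and n: "0 < n" and c: "(\<Sum>l<n. c (g l)) = 1"
    and x: "\<And>i. i < num_vars X \<Longrightarrow> x i \<in> tuples (universe A) n"
    and xss: "\<And>j. j < num_cons X \<Longrightarrow> xss j \<in> tuples (rel A (con_sym X j)) n"
    and col: "\<And>j t. j < num_cons X \<Longrightarrow> t < length (con_scope X j) \<Longrightarrow>
        con_scope X j ! t < num_vars X \<and>
        labelled_mset g (map (\<lambda>y. y ! t) (xss j)) = labelled_mset g (x (con_scope X j ! t))"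
  shows "blp_affine_accepts X A"
proof (rule blp_affine_acceptsI[OF fin])
  let ?w = "\<lambda>i a. \<Sum>l<n. 1 / of_nat n * of_bool (x i ! l = a) :: rat"
  let ?p = "\<lambda>j y. \<Sum>l<n. 1 / of_nat n * of_bool (xss j ! l = y) :: rat"
  have "(\<Sum>l<n. 1 / of_nat n :: rat) = 1"
    using n by simp
  then have eqs: "relaxation_eqs X A ?w ?p"
    using relaxation_eqs_columns[where c = "\<lambda>_. 1 / of_nat n" and g = g, OF fin _ x xss col] by blast
  have nonneg: "0 \<le> (\<Sum>l<n. 1 / of_nat n * of_bool (z l) :: rat)" for z
    by (intro sum_nonneg) simp
  show "basic_lp X A ?w ?p"
    unfolding basic_lp_def by (intro conjI allI impI ballI eqs nonneg)
  \<comment> \<open>A uniform average of indicators is zero only if nothing occurs at all, and then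
    every weighted sum vanishes.\<close>
  have supp: "(\<Sum>l<n. c (g l) * of_bool (z l)) = 0"
    if "(\<Sum>l<n. 1 / of_nat n * of_bool (z l) :: rat) = 0" for z
  proof -
    have "\<forall>l\<in>{..<n}. 1 / of_nat n * of_bool (z l) = (0::rat)"
      using that by (subst (asm) sum_nonneg_eq_0_iff) auto
    then show ?thesis
      using n by (intro sum.neutral) auto
  qed
  show "aff_refined X A ?w ?p (\<lambda>i a. \<Sum>l<n. c (g l) * of_bool (x i ! l = a))
      (\<lambda>j y. \<Sum>l<n. c (g l) * of_bool (xss j ! l = y))"
    unfolding aff_refined_def
    by (intro conjI allI impI ballI supp relaxation_eqs_columns[OF fin c x xss col])
qed

text \<open>A satisfying assignment is the case of a single coordinate, in one block of weight
  1.\<close>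

lemma satisfiable_imp_blp_affine_accepts:
  assumes A: "rel_structure S A" and X: "pcsp_instance S X" and sat: "satisfiable X A"
  shows "blp_affine_accepts X A"
proof -
  obtain \<sigma> where \<sigma>: "\<And>i. i < num_vars X \<Longrightarrow> \<sigma> i \<in> universe A"
    "\<And>j. j < num_cons X \<Longrightarrow> map \<sigma> (con_scope X j) \<in> rel A (con_sym X j)"
    using sat by (auto simp: satisfiable_def)
  have "con_scope X j ! t < num_vars X" if "j < num_cons X" "t < length (con_scope X j)" for j t
    using X that by (auto simp: pcsp_instance_def tuples_def subset_iff)
  then show ?thesis
    using \<sigma> X rel_structureD[OF A]
    by (intro blp_affine_accepts_columns[where n = 1 and c = "\<lambda>_. 1" and g = "\<lambda>_. ()"
          and x = "\<lambda>i. [\<sigma> i]" and xss = "\<lambda>j. [map \<sigma> (con_scope X j)]"])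
      (auto simp: tuples_def pcsp_instance_def)
qed


section \<open>The instance of orbits\<close>

text \<open>The polymorphism conditions for the symbols in \<open>F\<close> form an instance whose
  variables are orbits. The algorithm accepts it, since the columns of each \<open>xss\<close>
  provide the required solutions. \<open>F\<close> is finite because an instance has finitely many
  constraints.\<close>

lemma orbit_assignment_finite:
  fixes S :: "'s signature" and A :: "('s, 'a) rel_struct" and B :: "('s, 'b) rel_struct"
    and c :: "'c \<Rightarrow> int"
  assumes A: "rel_structure S A" and solves: "blp_affine_solves S A B"
    and n: "0 < n" and c: "(\<Sum>l<n. c (g l)) = 1"
    and F: "finite F" "F \<subseteq> symbols S"
  obtains \<tau> where "\<And>x. x \<in> tuples (universe A) n \<Longrightarrow> \<tau> (labelled_mset g x) \<in> universe B"
    "\<And>R xss. R \<in> F \<Longrightarrow> xss \<in> tuples (rel A R) n \<Longrightarrow>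
       map (\<lambda>t. \<tau> (labelled_mset g (map (\<lambda>y. y ! t) xss))) [0..<arity S R] \<in> rel B R"
proof -
  let ?T = "tuples (universe A) n"
  let ?K = "labelled_mset g ` ?T"
  have "finite ?K"
    by (simp add: finite_tuples rel_structureD(1)[OF A])
  \<comment> \<open>Variables of an instance are an initial segment of the naturals, so the orbits
    are numbered by \<open>e\<close>, with inverse \<open>idx\<close>.\<close>
  then obtain e where e: "bij_betw e {..<card ?K} ?K"
    using ex_bij_betw_nat_finite lessThan_atLeast0 by metis
  define idx where "idx = inv_into {..<card ?K} e"
  have idx: "idx k < card ?K" "e (idx k) = k" if "k \<in> ?K" for k
    using bij_betw_inv_into_right[OF e that] bij_betwE[OF bij_betw_inv_into[OF e]] that
    by (auto simp: idx_def)
  have "\<exists>x\<in>?T. labelled_mset g x = e i" if "i < card ?K" for i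
  proof -
    have "e i \<in> ?K"
      using bij_betwE[OF e] that by blast
    then show ?thesis
      by auto
  qed
  then obtain x where x: "\<And>i. i < card ?K \<Longrightarrow> x i \<in> ?T"
    "\<And>i. i < card ?K \<Longrightarrow> labelled_mset g (x i) = e i"
    by metis
  have "finite (SIGMA R:F. tuples (rel A R) n)"
    using F rel_structureD(2)[OF A] by (auto intro!: finite_SigmaI finite_tuples)
  then obtain zs where zs: "set zs = (SIGMA R:F. tuples (rel A R) n)"
    using finite_list by blast
  define orb where "orb xss t = labelled_mset g (map (\<lambda>y. y ! t) xss)" for xss :: "'a list list" and t
  \<comment> \<open>There is one constraint for each symbol in \<open>F\<close> and each list of
    \<open>n\<close> tuples of its relation, imposed on the orbits of the columns.\<close>
  define X where "X = \<lparr>num_vars = card ?K,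
    constraints = map (\<lambda>(R, xss). (R, map (\<lambda>t. idx (orb xss t)) [0..<arity S R])) zs\<rparr>"
  have z: "fst (zs ! j) \<in> F" "snd (zs ! j) \<in> tuples (rel A (fst (zs ! j))) n" if "j < length zs" for j
    using that zs nth_mem[OF that] by (auto simp: mem_Sigma_iff split: prod.splits)
  have orb: "orb xss t \<in> ?K" if "R \<in> F" "xss \<in> tuples (rel A R) n" "t < arity S R" for R xss t
    unfolding orb_def using column_in_tuples[OF A _ that(2,3)] that(1) F(2) by blast
  have X_sel: "num_vars X = card ?K" "num_cons X = length zs"
    "j < length zs \<Longrightarrow> con_sym X j = fst (zs ! j)"
    "j < length zs \<Longrightarrow>
       con_scope X j = map (\<lambda>t. idx (orb (snd (zs ! j)) t)) [0..<arity S (fst (zs ! j))]" for j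
    by (auto simp: X_def split: prod.splits)
  have orb_zs: "orb (snd (zs ! j)) t \<in> ?K" if "j < length zs" "t < arity S (fst (zs ! j))" for j t
    using that z orb by blast
  from idx(1)[OF this] have "pcsp_instance S X"
    using z(1) F(2) by (auto simp: pcsp_instance_def X_sel tuples_def)
  moreover have "blp_affine_accepts X A"
  proof (rule blp_affine_accepts_columns[where n = n and g = g and c = c and x = x
        and xss = "\<lambda>j. snd (zs ! j)"])
    show "finite (rel A (con_sym X j))" if "j < num_cons X" for j
      using that z F(2) rel_structureD(2)[OF A] by (auto simp: X_sel)
    show "con_scope X j ! t < num_vars X \<and>
        labelled_mset g (map (\<lambda>y. y ! t) (snd (zs ! j))) = labelled_mset g (x (con_scope X j ! t))"
      if "j < num_cons X" "t < length (con_scope X j)" for j t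
    proof -
      have "orb (snd (zs ! j)) t \<in> ?K"
        using that orb_zs by (simp add: X_sel)
      then show ?thesis
        using that idx[of "orb (snd (zs ! j)) t"] x(2) by (auto simp: X_sel orb_def)
    qed
  qed (use x z n c rel_structureD(1)[OF A] in \<open>auto simp: X_sel\<close>)
  \<comment> \<open>Correctness enters here: an accepted instance cannot be unsatisfiable in
    \<open>B\<close>.\<close>
  ultimately have "satisfiable X B"
    using solves by (auto simp: blp_affine_solves_def)
  then obtain \<sigma> where \<sigma>: "\<And>i. i < card ?K \<Longrightarrow> \<sigma> i \<in> universe B"
    "\<And>j. j < length zs \<Longrightarrow> map \<sigma> (con_scope X j) \<in> rel B (fst (zs ! j))"
    by (auto simp: satisfiable_def X_sel)
  show thesis
  proof (rule that[of "\<sigma> \<circ> idx"])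
    show "(\<sigma> \<circ> idx) (labelled_mset g x) \<in> universe B" if "x \<in> ?T" for x
      using that idx(1) \<sigma>(1) by auto
    show "map (\<lambda>t. (\<sigma> \<circ> idx) (labelled_mset g (map (\<lambda>y. y ! t) xss))) [0..<arity S R] \<in> rel B R"
      if "R \<in> F" "xss \<in> tuples (rel A R) n" for R xss
    proof -
      have "(R, xss) \<in> set zs"
        using that zs by simp
      then obtain j where "j < length zs" "zs ! j = (R, xss)"
        by (auto simp: in_set_conv_nth)
      then show ?thesis
        using \<sigma>(2)[of j] by (simp add: X_sel orb_def comp_def)
    qed
  qed
qed

text \<open>The signature may be infinite while an instance is finite. Since there are only finitely
  many maps from orbits to \<open>B\<close>, finitely many symbols suffice to exclude all of them.\<close>

lemma orbit_assignment:
  fixes S :: "'s signature" and A :: "('s, 'a) rel_struct" and B :: "('s, 'b) rel_struct"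
    and c :: "'c \<Rightarrow> int"
  assumes A: "rel_structure S A" and B: "rel_structure S B" and solves: "blp_affine_solves S A B"
    and n: "0 < n" and c: "(\<Sum>l<n. c (g l)) = 1"
  obtains \<tau> where "(\<lambda>x. \<tau> (labelled_mset g x)) \<in> Pol S A B n"
proof -
  let ?K = "labelled_mset g ` tuples (universe A) n"
  \<comment> \<open>Extensional functions make the set of candidate assignments finite.\<close>
  let ?M = "?K \<rightarrow>\<^sub>E universe B"
  define good where "good \<tau> R \<longleftrightarrow> (\<forall>xss\<in>tuples (rel A R) n.
      map (\<lambda>t. \<tau> (labelled_mset g (map (\<lambda>y. y ! t) xss))) [0..<arity S R] \<in> rel B R)" for \<tau> R
  have "finite ?M"
    by (intro finite_PiE finite_imageI finite_tuples rel_structureD(1)[OF A] rel_structureD(1)[OF B])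
  have "\<exists>\<tau>\<in>?M. \<forall>R\<in>symbols S. good \<tau> R"
  proof (rule ccontr)
    assume "\<not> ?thesis"
    \<comment> \<open>\<open>bad\<close> picks a violated symbol for each candidate; its finite
      image is the set of symbols given to the orbit instance.\<close>
    then obtain bad where bad: "\<And>\<tau>. \<tau> \<in> ?M \<Longrightarrow> bad \<tau> \<in> symbols S \<and> \<not> good \<tau> (bad \<tau>)"
      by metis
    obtain \<tau> where \<tau>: "\<And>x. x \<in> tuples (universe A) n \<Longrightarrow> \<tau> (labelled_mset g x) \<in> universe B"
      "\<And>R xss. R \<in> bad ` ?M \<Longrightarrow> xss \<in> tuples (rel A R) n \<Longrightarrow>
         map (\<lambda>t. \<tau> (labelled_mset g (map (\<lambda>y. y ! t) xss))) [0..<arity S R] \<in> rel B R"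
      using orbit_assignment_finite[where c = c and g = g and F = "bad ` ?M", OF A solves n c]
        \<open>finite ?M\<close> bad by blast
    \<comment> \<open>Restricting \<tau> to the orbits makes it a candidate without changing any
      value that matters. It then respects the very symbol that \<open>bad\<close> assigns to it, a
      contradiction.\<close>
    have \<tau>': "restrict \<tau> ?K \<in> ?M"
      using \<tau>(1) by auto
    have "good (restrict \<tau> ?K) R" if "R \<in> bad ` ?M" for R
      unfolding good_def
    proof
      fix xss
      assume xss: "xss \<in> tuples (rel A R) n"
      have "map (\<lambda>t. restrict \<tau> ?K (labelled_mset g (map (\<lambda>y. y ! t) xss))) [0..<arity S R]
          = map (\<lambda>t. \<tau> (labelled_mset g (map (\<lambda>y. y ! t) xss))) [0..<arity S R]"
        using column_in_tuples[OF A _ xss] bad that by (intro map_cong) auto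
      then show "map (\<lambda>t. restrict \<tau> ?K (labelled_mset g (map (\<lambda>y. y ! t) xss))) [0..<arity S R]
          \<in> rel B R"
        using \<tau>(2)[OF that xss] by (simp only:)
    qed
    then show False
      using bad[OF \<tau>'] \<tau>' by blast
  qed
  then obtain \<tau> where "\<tau> \<in> ?M" "\<forall>R\<in>symbols S. good \<tau> R"
    by blast
  then have "(\<lambda>x. \<tau> (labelled_mset g x)) \<in> Pol S A B n"
    using n by (auto simp: Pol_def good_def)
  then show thesis
    by (rule that)
qed

lemma solves_imp_two_blocks:
  fixes S :: "'s signature" and A :: "('s, 'a) rel_struct" and B :: "('s, 'b) rel_struct"
  assumes A: "rel_structure S A" and B: "rel_structure S B" and solves: "blp_affine_solves S A B"
  shows "\<exists>f\<in>Pol S A B (2 * L + 1). \<exists>K1 K2.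
           K1 \<union> K2 = {..<2 * L + 1} \<and> K1 \<inter> K2 = {} \<and> card K1 = L \<and> card K2 = L + 1 \<and>
           block_symmetric (universe A) (2 * L + 1) f {K1, K2}"
proof -
  let ?n = "2 * L + 1"
  let ?K1 = "{..<L}" and ?K2 = "{L..<?n}"
  define g where "g l \<longleftrightarrow> l < L" for l
  have K: "?K1 \<union> ?K2 = {..<?n}" "?K1 \<inter> ?K2 = {}" "card ?K1 = L" "card ?K2 = L + 1"
    by auto
  \<comment> \<open>The total weight is -L + (L + 1) = 1, also for L = 0, where the first block is
    empty.\<close>
  have "(\<Sum>l<?n. if g l then - 1 else 1 :: int)
      = (\<Sum>l\<in>?K1. if g l then - 1 else 1) + (\<Sum>l\<in>?K2. if g l then - 1 else 1)"
    by (subst K(1)[symmetric], rule sum.union_disjoint) auto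
  also have "\<dots> = 1"
    by (simp add: g_def)
  finally obtain \<tau> where pol: "(\<lambda>x. \<tau> (labelled_mset g x)) \<in> Pol S A B ?n"
    using orbit_assignment[OF A B solves, of ?n "\<lambda>b. if b then - 1 else 1" g] by auto
  have "block_symmetric (universe A) ?n (\<lambda>x. \<tau> (labelled_mset g x)) {?K1, ?K2}"
    unfolding block_symmetric_def
  proof (intro allI impI ballI)
    fix \<pi> and x :: "'a list"
    assume \<pi>: "\<pi> permutes {..<?n} \<and> (\<forall>K\<in>{?K1, ?K2}. \<pi> ` K = K)" and x: "x \<in> tuples (universe A) ?n"
    have "g (\<pi> l) = g l" if "l < ?n" for l
    proof (cases "l < L")
      case True
      then have "\<pi> l \<in> ?K1"
        using \<pi> by blast
      then show ?thesis
        using True by (simp add: g_def)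
    next
      case False
      then have "\<pi> l \<in> ?K2"
        using \<pi> that by (metis atLeastLessThan_iff image_eqI insertCI linorder_not_less)
      then show ?thesis
        using False by (simp add: g_def)
    qed
    then show "\<tau> (labelled_mset g (permute_list \<pi> x)) = \<tau> (labelled_mset g x)"
      using labelled_mset_permute_list[of \<pi> x g] \<pi> x by (simp add: tuples_def)
  qed
  then show ?thesis
    using pol K by blast
qed


section \<open>Width\<close>

text \<open>Finiteness gives the \<open>Max\<close> in \<open>width\<close> its intended
  meaning.\<close>

lemma finite_widths: "finite {Min (card ` P) | P. partition_on {..<L} P \<and> block_symmetric U L f P}"
proof -
  have "finite {P. partition_on {..<L} P}"
    by (rule finite_subset[of _ "Pow (Pow {..<L})"]) (auto simp: partition_on_def)
  then show ?thesis
    by (rule finite_surj[where f = "\<lambda>P. Min (card ` P)"]) auto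
qed

text \<open>Positivity of \<open>L\<close> makes both blocks nonempty, as a partition
  requires.\<close>

lemma two_blocks_imp_width:
  assumes K: "K1 \<union> K2 = {..<2 * L + 1}" "K1 \<inter> K2 = {}" "card K1 = L" "card K2 = L + 1"
    and "0 < L" and sym: "block_symmetric U (2 * L + 1) f {K1, K2}"
  shows "L \<le> width U (2 * L + 1) f"
proof -
  have "partition_on {..<2 * L + 1} {K1, K2}"
    using K \<open>0 < L\<close> by (auto simp: partition_on_def disjoint_def)
  moreover have "Min (card ` {K1, K2}) = L"
    using K by simp
  ultimately have "L \<in> {Min (card ` P) | P.
      partition_on {..<2 * L + 1} P \<and> block_symmetric U (2 * L + 1) f P}"
    using sym by (intro CollectI exI[of _ "{K1, K2}"] conjI) (simp_all only:)
  then show ?thesis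
    unfolding width_def by (rule Max_ge[OF finite_widths])
qed

text \<open>The maximum is attained because some partition always qualifies: only the identity
  preserves every singleton block.\<close>

lemma width_obtain_partition:
  fixes U :: "'a set"
  obtains P where "partition_on {..<L} P" "block_symmetric U L f P"
    "\<And>K. K \<in> P \<Longrightarrow> width U L f \<le> card K"
proof -
  let ?W = "{Min (card ` P) | P. partition_on {..<L} P \<and> block_symmetric U L f P}"
  let ?P = "(\<lambda>l. {l}) ` {..<L}"
  have "partition_on {..<L} ?P"
    by (auto simp: partition_on_def disjoint_def)
  moreover have "block_symmetric U L f ?P"
    unfolding block_symmetric_def
  proof (intro allI impI ballI)
    fix \<pi> and x :: "'a list"
    assume \<pi>: "\<pi> permutes {..<L} \<and> (\<forall>K\<in>?P. \<pi> ` K = K)"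
    have "\<pi> l = l" for l
    proof (cases "l < L")
      case True
      then show ?thesis
        using \<pi> by auto
    next
      case False
      then show ?thesis
        using \<pi> permutes_not_in[of \<pi> "{..<L}" l] by simp
    qed
    then have "\<pi> = id"
      by auto
    then show "f (permute_list \<pi> x) = f x"
      by simp
  qed
  ultimately have "?W \<noteq> {}"
    by blast
  then have "width U L f \<in> ?W"
    unfolding width_def by (intro Max_in finite_widths)
  then obtain P where P: "width U L f = Min (card ` P)" "partition_on {..<L} P"
    "block_symmetric U L f P"
    by blast
  have "finite P"
    using P(2) finite_elements by blast
  then show thesis
    using that P by (metis Min_le finite_imageI imageI)
qed

text \<open>Labelling positions by their blocks, equal counts give equal labelled multisets, hence a
  block-preserving permutation from one tuple to the other.\<close>

lemma block_symmetric_eq: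
  assumes P: "partition_on {..<L} P" and sym: "block_symmetric U L f P"
    and xy: "x \<in> tuples U L" "y \<in> tuples U L"
    and cards: "\<And>K a. K \<in> P \<Longrightarrow> a \<in> U \<Longrightarrow> card {l \<in> K. x ! l = a} = card {l \<in> K. y ! l = a}"
  shows "f x = f y"
proof -
  have len: "length x = L" "length y = L"
    using xy by (auto simp: tuples_def)
  have "\<exists>K\<in>P. l \<in> K" if "l < L" for l
    using P that by (auto simp: partition_on_def)
  then obtain g where g: "\<And>l. l < L \<Longrightarrow> g l \<in> P \<and> l \<in> g l"
    by metis
  have g_eq: "l \<in> K \<longleftrightarrow> l < L \<and> g l = K" if "K \<in> P" for l K
    using g P that unfolding partition_on_def disjoint_def by blast
  have "labelled_mset g x = labelled_mset g y"
  proof (rule labelled_mset_eqI)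
    show "card {l \<in> {..<length y}. g l = b \<and> x ! l = a} = card {l \<in> {..<length y}. g l = b \<and> y ! l = a}"
      for b a
    proof (cases "b \<in> P \<and> a \<in> U")
      case True
      then have "{l \<in> {..<length y}. g l = b \<and> z ! l = a} = {l \<in> b. z ! l = a}" for z
        using g_eq len by auto
      then show ?thesis
        using cards True by simp
    next
      case False
      have "x ! l \<in> U" "y ! l \<in> U" if "l < L" for l
        using xy that tuples_nth by blast+
      then have "{l \<in> {..<length y}. g l = b \<and> x ! l = a} = {}"
        "{l \<in> {..<length y}. g l = b \<and> y ! l = a} = {}"
        using False g len by auto
      then show ?thesis
        by (simp only:)
    qed
  qed (simp add: len)
  then obtain \<pi> where \<pi>: "\<pi> permutes {..<L}" "\<And>l. l < L \<Longrightarrow> g (\<pi> l) = g l" "x = permute_list \<pi> y"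
    using labelled_mset_eq_imp_permute_list[of x y g] len by metis
  \<comment> \<open>Preservation of labels only gives inclusion; injectivity on the finite block
    gives equality.\<close>
  have "\<pi> ` K = K" if K: "K \<in> P" for K
  proof (rule card_subset_eq)
    have "K \<subseteq> {..<L}"
      using P K by (auto simp: partition_on_def)
    then show "finite K"
      using finite_subset by blast
    show "\<pi> ` K \<subseteq> K"
    proof
      fix m
      assume "m \<in> \<pi> ` K"
      then obtain l where l: "m = \<pi> l" "l < L" "g l = K"
        using g_eq[OF K] by blast
      moreover have "\<pi> l < L"
        using permutes_in_image[OF \<pi>(1), of l] l(2) by simp
      ultimately show "m \<in> K"
        using g_eq[OF K, of m] \<pi>(2)[OF l(2)] by simp
    qed
    show "card (\<pi> ` K) = card K"
      using permutes_inj_on[OF \<pi>(1)] by (rule card_image)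
  qed
  then show ?thesis
    using sym \<pi>(1,3) xy(2) by (auto simp: block_symmetric_def)
qed


section \<open>Rounding an LP solution and an affine solution\<close>

text \<open>The total 1 is replaced by \<open>b\<close>, so that nonnegative integer solutions can
  be read as numbers of occurrences in a block of size \<open>b\<close>.\<close>

definition scaled_eqs ::
  "'s pcsp_inst \<Rightarrow> ('s, 'a) rel_struct \<Rightarrow> 'n::comm_ring_1 \<Rightarrow>
   (nat \<Rightarrow> 'a \<Rightarrow> 'n) \<Rightarrow> (nat \<Rightarrow> 'a list \<Rightarrow> 'n) \<Rightarrow> bool" where
  "scaled_eqs X A b w p \<longleftrightarrow>
     (\<forall>i<num_vars X. (\<Sum>a\<in>universe A. w i a) = b) \<and>
     (\<forall>j<num_cons X. (\<Sum>y\<in>rel A (con_sym X j). p j y) = b) \<and>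
     (\<forall>j<num_cons X. \<forall>t<length (con_scope X j). \<forall>a\<in>universe A.
        (\<Sum>y | y \<in> rel A (con_sym X j) \<and> y ! t = a. p j y) = w (con_scope X j ! t) a)"

lemma relaxation_eqs_scaled: "relaxation_eqs X A w p \<longleftrightarrow> scaled_eqs X A 1 w p"
  by (simp add: relaxation_eqs_def scaled_eqs_def)

lemma scaled_eqs_combine:
  assumes "scaled_eqs X A b w p" "scaled_eqs X A b' w' p'"
  shows "scaled_eqs X A (c * b + c' * b') (\<lambda>i a. c * w i a + c' * w' i a)
           (\<lambda>j y. c * p j y + c' * p' j y)"
  using assms by (simp add: scaled_eqs_def sum.distrib flip: sum_distrib_left)

lemma scaled_eqs_of_int:
  assumes "scaled_eqs X A (of_int b) (\<lambda>i a. of_int (w i a) :: rat) (\<lambda>j y. of_int (p j y))"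
  shows "scaled_eqs X A b w p"
  using assms by (simp add: scaled_eqs_def flip: of_int_sum)

text \<open>Floors and \<open>nat\<close> are only known to be exact on the variables, values and
  tuples of the instance; the scope condition keeps the equations within that range.\<close>

lemma scaled_eqs_cong:
  assumes "scaled_eqs X A b w p"
    and "\<And>i a. i < num_vars X \<Longrightarrow> a \<in> universe A \<Longrightarrow> w i a = w' i a"
    and "\<And>j y. j < num_cons X \<Longrightarrow> y \<in> rel A (con_sym X j) \<Longrightarrow> p j y = p' j y"
    and "\<And>j t. j < num_cons X \<Longrightarrow> t < length (con_scope X j) \<Longrightarrow> con_scope X j ! t < num_vars X"
  shows "scaled_eqs X A b w' p'"
proof -
  have "(\<Sum>a\<in>universe A. w i a) = (\<Sum>a\<in>universe A. w' i a)" if "i < num_vars X" for i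
    using that assms(2) by (intro sum.cong) auto
  moreover have "(\<Sum>y\<in>rel A (con_sym X j). p j y) = (\<Sum>y\<in>rel A (con_sym X j). p' j y)"
    "(\<Sum>y | y \<in> rel A (con_sym X j) \<and> y ! t = a. p j y)
      = (\<Sum>y | y \<in> rel A (con_sym X j) \<and> y ! t = a. p' j y)" if "j < num_cons X" for j t a
    using that assms(3) by (auto intro!: sum.cong)
  ultimately show ?thesis
    using assms(1,2,4) by (simp add: scaled_eqs_def)
qed

lemma common_denominator:
  fixes Q :: "rat set"
  assumes "finite Q"
  obtains D :: nat where "0 < D" "\<And>q. q \<in> Q \<Longrightarrow> of_nat D * q \<in> \<int>"
proof -
  have "\<exists>D::nat. 0 < D \<and> (\<forall>q\<in>Q. of_nat D * q \<in> \<int>)"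
    using assms
  proof induction
    case (insert q Q)
    then obtain D :: nat where D: "0 < D" "\<And>q. q \<in> Q \<Longrightarrow> of_nat D * q \<in> \<int>"
      by auto
    obtain a b where ab: "q = of_int a / of_int b" "0 < b"
      by (cases q) (auto simp: Fract_of_int_quotient)
    let ?E = "D * nat b"
    have "of_nat ?E * q = of_int (int D * a)"
      using ab by simp
    then have "of_nat ?E * q \<in> \<int>"
      by (metis Ints_of_int)
    moreover have "of_nat ?E * q' \<in> \<int>" if "q' \<in> Q" for q'
    proof -
      have "of_nat ?E * q' = of_nat (nat b) * (of_nat D * q')"
        by simp
      then show ?thesis
        using D(2)[OF that] by (metis Ints_mult Ints_of_nat)
    qed
    ultimately show ?case
      using D(1) ab(2) by (intro exI[of _ ?E]) auto
  qed auto
  then show thesis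
    using that by blast
qed

text \<open>A nonzero \<open>u\<close> is at least 1 by integrality, so \<open>k * u\<close> is at
  least \<open>D * M\<close>, which bounds the absolute value of \<open>e * r\<close>.\<close>

lemma nonneg_rounding:
  fixes u r :: int
  assumes "0 \<le> u" "u = 0 \<longrightarrow> r = 0" "\<bar>r\<bar> \<le> M" "0 \<le> e" "e \<le> D" "D * M \<le> k"
  shows "0 \<le> k * u + e * r"
proof (cases "u = 0")
  case False
  have M: "0 \<le> M"
    using assms(3) by linarith
  have "\<bar>e * r\<bar> \<le> D * M"
    unfolding abs_mult using assms by (intro mult_mono) auto
  moreover have "0 \<le> k"
    using M assms by (meson mult_nonneg_nonneg order_trans)
  then have "k * 1 \<le> k * u"
    using False assms(1) by (intro mult_left_mono) auto
  ultimately show ?thesis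
    using assms(6) by linarith
qed (use assms in simp)

lemma scaled_nat_solutions:
  assumes fin: "finite (universe A)" "\<And>j. j < num_cons X \<Longrightarrow> finite (rel A (con_sym X j))"
    and scope: "\<And>j t. j < num_cons X \<Longrightarrow> t < length (con_scope X j) \<Longrightarrow> con_scope X j ! t < num_vars X"
    and lp: "basic_lp X A w p" and aff: "aff_refined X A w p r q"
  obtains N where "\<And>b. N \<le> b \<Longrightarrow> \<exists>W P. scaled_eqs X A (int b) (\<lambda>i a. int (W i a)) (\<lambda>j y. int (P j y))"
proof -
  define I where "I = {..<num_vars X} \<times> universe A"
  define J where "J = (SIGMA j:{..<num_cons X}. rel A (con_sym X j))"
  have finIJ: "finite I" "finite J"
    using fin by (auto simp: I_def J_def)
  obtain D :: nat where D: "0 < D"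
    and Dw: "\<And>z. z \<in> case_prod w ` I \<union> case_prod p ` J \<Longrightarrow> of_nat D * z \<in> \<int>"
    using common_denominator[of "case_prod w ` I \<union> case_prod p ` J"] finIJ by blast
  \<comment> \<open>Inserting 0 keeps the maximum defined and nonnegative even if there are no
    entries.\<close>
  define M where "M = Max (insert 0 (abs ` (case_prod r ` I \<union> case_prod q ` J)))"
  have M: "0 \<le> M" "\<And>z. z \<in> case_prod r ` I \<union> case_prod q ` J \<Longrightarrow> \<bar>z\<bar> \<le> M"
    using finIJ by (auto simp: M_def intro!: Max_ge)
  \<comment> \<open>The floor is exact on the instance, since \<open>D\<close> clears all
    denominators.\<close>
  define u where "u i a = \<lfloor>of_nat D * w i a\<rfloor>" for i a
  define v where "v j y = \<lfloor>of_nat D * p j y\<rfloor>" for j y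
  have u: "of_int (u i a) = of_nat D * w i a" "0 \<le> u i a" "u i a = 0 \<longrightarrow> r i a = 0" "\<bar>r i a\<bar> \<le> M"
    if "i < num_vars X" "a \<in> universe A" for i a
  proof -
    have ia: "(i, a) \<in> I"
      using that by (simp add: I_def)
    then show eq: "of_int (u i a) = of_nat D * w i a"
      unfolding u_def by (intro of_int_floor Dw UnI1) force
    show "0 \<le> u i a"
      using lp that by (simp add: u_def basic_lp_def)
    show "u i a = 0 \<longrightarrow> r i a = 0"
      using aff that D eq by (auto simp: aff_refined_def)
    show "\<bar>r i a\<bar> \<le> M"
      using ia by (intro M UnI1) force
  qed
  have v: "of_int (v j y) = of_nat D * p j y" "0 \<le> v j y" "v j y = 0 \<longrightarrow> q j y = 0" "\<bar>q j y\<bar> \<le> M"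
    if "j < num_cons X" "y \<in> rel A (con_sym X j)" for j y
  proof -
    have jy: "(j, y) \<in> J"
      using that by (simp add: J_def)
    then show eq: "of_int (v j y) = of_nat D * p j y"
      unfolding v_def by (intro of_int_floor Dw UnI2) force
    show "0 \<le> v j y"
      using lp that by (simp add: v_def basic_lp_def)
    show "v j y = 0 \<longrightarrow> q j y = 0"
      using aff that D eq by (auto simp: aff_refined_def)
    show "\<bar>q j y\<bar> \<le> M"
      using jy by (intro M UnI2) force
  qed
  \<comment> \<open>The zero terms let the lemma on combinations serve for plain scaling by
    \<open>D\<close>.\<close>
  have "scaled_eqs X A (of_nat D * 1 + 0 * 1) (\<lambda>i a. of_nat D * w i a + 0 * w i a)
      (\<lambda>j y. of_nat D * p j y + 0 * p j y)"
    using lp by (intro scaled_eqs_combine) (auto simp: basic_lp_def relaxation_eqs_scaled)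
  then have "scaled_eqs X A (of_int (int D)) (\<lambda>i a. of_int (u i a) :: rat) (\<lambda>j y. of_int (v j y))"
    by (auto intro: scaled_eqs_cong simp: u v scope)
  then have uv: "scaled_eqs X A (int D) u v"
    by (rule scaled_eqs_of_int)
  have rq: "scaled_eqs X A 1 r q"
    using aff by (simp add: aff_refined_def relaxation_eqs_scaled)
  show thesis
  proof (rule that)
    fix b
    \<comment> \<open>The threshold makes the quotient \<open>k\<close> at least
      \<open>D * M\<close>, while the remainder \<open>e\<close> stays below
      \<open>D\<close>.\<close>
    assume b: "D * (D * nat M) \<le> b"
    define k where "k = int (b div D)"
    define e where "e = int (b mod D)"
    have "D * nat M \<le> b div D"
      using b D by (simp add: less_eq_div_iff_mult_less_eq mult.commute)
    then have k: "int D * M \<le> k"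
      using M(1) unfolding k_def by (metis int_nat_eq of_nat_le_iff of_nat_mult)
    have e: "0 \<le> e" "e \<le> int D"
      using D by (simp_all add: e_def less_imp_le)
    have "k * int D + e * 1 = int b"
      by (simp add: k_def e_def flip: of_nat_mult of_nat_add)
    then have "scaled_eqs X A (int b) (\<lambda>i a. k * u i a + e * r i a) (\<lambda>j y. k * v j y + e * q j y)"
      using scaled_eqs_combine[OF uv rq, of k e] by simp
    then have "scaled_eqs X A (int b) (\<lambda>i a. int (nat (k * u i a + e * r i a)))
        (\<lambda>j y. int (nat (k * v j y + e * q j y)))"
      using nonneg_rounding[OF u(2-4) e k] nonneg_rounding[OF v(2-4) e k] scope
      by (elim scaled_eqs_cong) auto
    then show "\<exists>W P. scaled_eqs X A (int b) (\<lambda>i a. int (W i a)) (\<lambda>j y. int (P j y))"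
      by (intro exI[of _ "\<lambda>i a. nat (k * u i a + e * r i a)"]
          exI[of _ "\<lambda>j y. nat (k * v j y + e * q j y)"])
  qed
qed

section \<open>Tuples with prescribed counts in each block\<close>

lemma function_with_fibre_cards:
  assumes "finite U" "finite K" "sum c U = card K"
  obtains h where "h ` K \<subseteq> U" "\<And>a. a \<in> U \<Longrightarrow> card {l \<in> K. h l = a} = c a"
proof -
  have "\<exists>h. h ` K \<subseteq> U \<and> (\<forall>a\<in>U. card {l \<in> K. h l = a} = c a)"
    using assms
  proof (induction U arbitrary: K)
    case empty
    then show ?case
      by simp
  next
    case (insert b U)
    \<comment> \<open>A subset of size \<open>c b\<close> is reserved for the new value
      \<open>b\<close>; the induction hypothesis distributes the rest.\<close>
    then obtain K' where K': "K' \<subseteq> K" "card K' = c b"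
      by (metis le_add1 obtain_subset_with_card_n sum.insert)
    have "sum c U = card (K - K')"
      using insert K' by (simp add: card_Diff_subset finite_subset)
    then obtain h where h: "h ` (K - K') \<subseteq> U" "\<And>a. a \<in> U \<Longrightarrow> card {l \<in> K - K'. h l = a} = c a"
      using insert.IH[of "K - K'"] insert.prems by auto
    let ?h = "\<lambda>l. if l \<in> K' then b else h l"
    have "{l \<in> K. ?h l = b} = K'"
      using K' h(1) insert.hyps(2) by auto
    moreover have "{l \<in> K. ?h l = a} = {l \<in> K - K'. h l = a}" if "a \<in> U" for a
      using that insert.hyps(2) by auto
    ultimately show ?case
      using h K' by (intro exI[of _ ?h]) auto
  qed
  then show thesis
    using that by blast
qed

text \<open>The blocks are disjoint and cover all positions, so functions chosen separately on them
  glue to one tuple.\<close>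

lemma tuple_with_block_cards:
  assumes U: "finite U" and P: "partition_on {..<L} P"
    and c: "\<And>K. K \<in> P \<Longrightarrow> sum (c K) U = card K"
  obtains x where "x \<in> tuples U L" "\<And>K a. K \<in> P \<Longrightarrow> a \<in> U \<Longrightarrow> card {l \<in> K. x ! l = a} = c K a"
proof -
  have sub: "K \<subseteq> {..<L}" if "K \<in> P" for K
    using P that by (auto simp: partition_on_def)
  have "\<exists>h. h ` K \<subseteq> U \<and> (\<forall>a\<in>U. card {l \<in> K. h l = a} = c K a)" if "K \<in> P" for K
  proof -
    have "finite K"
      using sub[OF that] by (rule finite_subset) simp
    from function_with_fibre_cards[OF U this c[OF that]] show ?thesis
      by metis
  qed
  then obtain h where h: "\<And>K. K \<in> P \<Longrightarrow> h K ` K \<subseteq> U"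
    "\<And>K a. K \<in> P \<Longrightarrow> a \<in> U \<Longrightarrow> card {l \<in> K. h K l = a} = c K a"
    by metis
  have "\<exists>K\<in>P. l \<in> K" if "l < L" for l
    using P that by (auto simp: partition_on_def)
  then obtain g where g: "\<And>l. l < L \<Longrightarrow> g l \<in> P \<and> l \<in> g l"
    by metis
  have g_eq: "g l = K" if "K \<in> P" "l \<in> K" for l K
    using g[of l] sub[OF that(1)] P that unfolding partition_on_def disjoint_def by blast
  let ?x = "map (\<lambda>l. h (g l) l) [0..<L]"
  have tup: "?x \<in> tuples U L"
    using g h(1) by (fastforce simp: tuples_def)
  have "{l \<in> K. ?x ! l = a} = {l \<in> K. h K l = a}" if "K \<in> P" for K a
    using sub[OF that] g_eq[OF that] by auto
  then have "card {l \<in> K. ?x ! l = a} = c K a" if "K \<in> P" "a \<in> U" for K a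
    using h(2) that by (simp only:)
  with tup show thesis
    by (rule that)
qed

text \<open>Counts in a column are marginals of the counts of whole tuples, which is how the
  marginal equations enter.\<close>

lemma card_column_fibre:
  assumes "finite R" "finite K" "\<And>l. l \<in> K \<Longrightarrow> z l \<in> R"
  shows "card {l \<in> K. z l ! t = a} = (\<Sum>y | y \<in> R \<and> y ! t = a. card {l \<in> K. z l = y})"
proof -
  have "{l \<in> K. z l ! t = a} = (\<Union>y\<in>{y \<in> R. y ! t = a}. {l \<in> K. z l = y})"
    using assms(3) by auto
  moreover have "card \<dots> = (\<Sum>y | y \<in> R \<and> y ! t = a. card {l \<in> K. z l = y})"
    using assms(1,2) by (intro card_UN_disjoint) auto
  ultimately show ?thesis
    by simp
qed

text \<open>The solutions prescribe block counts for a tuple \<open>x i\<close> per variable and a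
  list \<open>z\<close> of relation tuples per constraint. By the marginal equations, a column of
  \<open>z\<close> has the block counts of the tuple of its variable, so \<open>f\<close> agrees on
  them. As \<open>f\<close> maps the columns of \<open>z\<close> into the relation of
  \<open>B\<close>, assigning \<open>f (x i)\<close> to variable \<open>i\<close> satisfies the
  constraint.\<close>

lemma satisfiable_if_block_solutions:
  assumes A: "rel_structure S A" and X: "pcsp_instance S X" and f: "f \<in> Pol S A B L"
    and P: "partition_on {..<L} P" and sym: "block_symmetric (universe A) L f P"
    and sol: "\<And>K. K \<in> P \<Longrightarrow>
      scaled_eqs X A (int (card K)) (\<lambda>i a. int (w K i a)) (\<lambda>j y. int (p K j y))"
  shows "satisfiable X B"
proof -
  have sums: "i < num_vars X \<Longrightarrow> sum (w K i) (universe A) = card K"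
    "j < num_cons X \<Longrightarrow> sum (p K j) (rel A (con_sym X j)) = card K"
    "j < num_cons X \<Longrightarrow> t < length (con_scope X j) \<Longrightarrow> a \<in> universe A \<Longrightarrow>
       (\<Sum>y | y \<in> rel A (con_sym X j) \<and> y ! t = a. p K j y) = w K (con_scope X j ! t) a"
    if "K \<in> P" for K i j t a
    using sol[OF that] by (auto simp: scaled_eqs_def simp flip: of_nat_sum)
  have "\<exists>x\<in>tuples (universe A) L. \<forall>K\<in>P. \<forall>a\<in>universe A. card {l \<in> K. x ! l = a} = w K i a"
    if "i < num_vars X" for i
    using tuple_with_block_cards[OF rel_structureD(1)[OF A] P, of "\<lambda>K. w K i"] sums(1) that by metis
  then obtain x where x: "\<And>i. i < num_vars X \<Longrightarrow> x i \<in> tuples (universe A) L"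
    "\<And>i K a. i < num_vars X \<Longrightarrow> K \<in> P \<Longrightarrow> a \<in> universe A \<Longrightarrow> card {l \<in> K. x i ! l = a} = w K i a"
    by metis
  have "map (\<lambda>i. f (x i)) (con_scope X j) \<in> rel B (con_sym X j)" if j: "j < num_cons X" for j
  proof -
    let ?R = "con_sym X j"
    have R: "?R \<in> symbols S" and len: "length (con_scope X j) = arity S ?R"
      and scope: "\<And>t. t < arity S ?R \<Longrightarrow> con_scope X j ! t < num_vars X"
      using X j by (auto simp: pcsp_instance_def tuples_def subset_iff)
    obtain z where z: "z \<in> tuples (rel A ?R) L"
      "\<And>K y. K \<in> P \<Longrightarrow> y \<in> rel A ?R \<Longrightarrow> card {l \<in> K. z ! l = y} = p K j y"
      by (rule tuple_with_block_cards[OF rel_structureD(2)[OF A R] P, of "\<lambda>K. p K j"])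
        (use sums(2) j in auto)
    have "f (map (\<lambda>y. y ! t) z) = f (x (con_scope X j ! t))" if t: "t < arity S ?R" for t
    proof (rule block_symmetric_eq[OF P sym])
      show "map (\<lambda>y. y ! t) z \<in> tuples (universe A) L"
        by (rule column_in_tuples[OF A R z(1) t])
      show "x (con_scope X j ! t) \<in> tuples (universe A) L"
        using x(1) scope t by blast
      fix K a
      assume K: "K \<in> P" and a: "a \<in> universe A"
      have "K \<subseteq> {..<L}"
        using P K by (auto simp: partition_on_def)
      then have KL: "finite K" "\<And>l. l \<in> K \<Longrightarrow> l < length z"
        using finite_subset[of K "{..<L}"] z(1) by (auto simp: tuples_def)
      then have mem: "\<And>l. l \<in> K \<Longrightarrow> z ! l \<in> rel A ?R"
        using tuples_nth[OF z(1)] z(1) by (simp add: tuples_def)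
      have "{l \<in> K. map (\<lambda>y. y ! t) z ! l = a} = {l \<in> K. z ! l ! t = a}"
        using KL(2) by auto
      also have "card \<dots> = (\<Sum>y | y \<in> rel A ?R \<and> y ! t = a. card {l \<in> K. z ! l = y})"
        by (rule card_column_fibre[OF rel_structureD(2)[OF A R] KL(1) mem])
      also have "\<dots> = (\<Sum>y | y \<in> rel A ?R \<and> y ! t = a. p K j y)"
        using z(2)[OF K] by (intro sum.cong) auto
      also have "\<dots> = card {l \<in> K. x (con_scope X j ! t) ! l = a}"
        using sums(3)[OF K j, of t a] x(2)[OF scope[OF t] K a] t a len by simp
      finally show "card {l \<in> K. map (\<lambda>y. y ! t) z ! l = a}
          = card {l \<in> K. x (con_scope X j ! t) ! l = a}" .
    qed
    then have "map (\<lambda>t. f (map (\<lambda>y. y ! t) z)) [0..<arity S ?R] = map (\<lambda>i. f (x i)) (con_scope X j)"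
      using len by (intro nth_equalityI) auto
    moreover have "map (\<lambda>t. f (map (\<lambda>y. y ! t) z)) [0..<arity S ?R] \<in> rel B ?R"
      using f R z(1) by (auto simp: Pol_def)
    ultimately show ?thesis
      by simp
  qed
  moreover have "f (x i) \<in> universe B" if "i < num_vars X" for i
    using f x(1)[OF that] by (auto simp: Pol_def)
  ultimately show ?thesis
    unfolding satisfiable_def by (intro exI[of _ "\<lambda>i. f (x i)"]) auto
qed

section \<open>From wide polymorphisms to correctness, and the equivalence\<close>

lemma width_imp_solves:
  fixes S :: "'s signature" and A :: "('s, 'a) rel_struct" and B :: "('s, 'b) rel_struct"
  assumes A: "rel_structure S A"
    and wide: "\<And>N. \<exists>L. \<exists>f\<in>Pol S A B L. N \<le> width (universe A) L f"
  shows "blp_affine_solves S A B"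
  unfolding blp_affine_solves_def
proof (intro allI impI conjI notI)
  fix X :: "'s pcsp_inst"
  assume X: "pcsp_instance S X"
  show "blp_affine_accepts X A" if "satisfiable X A"
    using satisfiable_imp_blp_affine_accepts[OF A X that] .
  assume unsat: "\<not> satisfiable X B" and "blp_affine_accepts X A"
  then obtain w p r q where wp: "basic_lp X A w p" "aff_refined X A w p r q"
    by (auto simp: blp_affine_accepts_def basic_lp_interior_def)
  have "finite (rel A (con_sym X j))" if "j < num_cons X" for j
    using X that rel_structureD(2)[OF A] by (auto simp: pcsp_instance_def)
  moreover have "con_scope X j ! t < num_vars X"
    if "j < num_cons X" "t < length (con_scope X j)" for j t
    using X that by (auto simp: pcsp_instance_def tuples_def subset_iff)
  ultimately obtain N where
    "\<And>b. N \<le> b \<Longrightarrow> \<exists>W P. scaled_eqs X A (int b) (\<lambda>i a. int (W i a)) (\<lambda>j y. int (P j y))"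
    using scaled_nat_solutions[OF rel_structureD(1)[OF A] _ _ wp] by blast
  then obtain W V where WV: "\<And>b. N \<le> b \<Longrightarrow>
      scaled_eqs X A (int b) (\<lambda>i a. int (W b i a)) (\<lambda>j y. int (V b j y))"
    by metis
  \<comment> \<open>The threshold \<open>N\<close> depends on the instance, so \<open>f\<close> is
    chosen only now; every block then has size at least \<open>N\<close>.\<close>
  obtain L f where f: "f \<in> Pol S A B L" "N \<le> width (universe A) L f"
    using wide by blast
  obtain P where P: "partition_on {..<L} P" "block_symmetric (universe A) L f P"
    "\<And>K. K \<in> P \<Longrightarrow> width (universe A) L f \<le> card K"
    using width_obtain_partition[of L "universe A" f] by blast
  have "satisfiable X B"
    using f P WV
    by (intro satisfiable_if_block_solutions[OF A X f(1) P(1,2),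
          where w = "\<lambda>K. W (card K)" and p = "\<lambda>K. V (card K)"]) force
  with unsat show False ..
qed

theorem theorem5p1:
  fixes S :: "'s signature" and A :: "('s, 'a) rel_struct" and B :: "('s, 'b) rel_struct"
  assumes "promise_template S A B"
  shows "(blp_affine_solves S A B \<longleftrightarrow>
            (\<forall>N. \<exists>L. \<exists>f\<in>Pol S A B L. N \<le> width (universe A) L f)) \<and>
         (blp_affine_solves S A B \<longleftrightarrow>
            (\<forall>L. \<exists>f\<in>Pol S A B (2 * L + 1). \<exists>K1 K2.
               K1 \<union> K2 = {..<2 * L + 1} \<and> K1 \<inter> K2 = {} \<and> card K1 = L \<and> card K2 = L + 1 \<and>
               block_symmetric (universe A) (2 * L + 1) f {K1, K2}))"
    (is "(?i \<longleftrightarrow> ?ii) \<and> (?i \<longleftrightarrow> ?iii)")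
proof -
  have A: "rel_structure S A" and B: "rel_structure S B"
    using assms by (auto simp: promise_template_def)
  have "?i \<Longrightarrow> ?iii"
    using solves_imp_two_blocks[OF A B] by blast
  moreover have ?ii if iii: ?iii
  proof
    fix N
    \<comment> \<open>\<open>Suc N\<close> in place of \<open>N\<close> keeps the smaller block
      nonempty when N = 0.\<close>
    obtain f K1 K2 where "f \<in> Pol S A B (2 * Suc N + 1)" "K1 \<union> K2 = {..<2 * Suc N + 1}"
      "K1 \<inter> K2 = {}" "card K1 = Suc N" "card K2 = Suc N + 1"
      "block_symmetric (universe A) (2 * Suc N + 1) f {K1, K2}"
      using iii by blast
    then show "\<exists>L. \<exists>f\<in>Pol S A B L. N \<le> width (universe A) L f"
      using two_blocks_imp_width[of K1 K2 "Suc N"] by (meson Suc_leD zero_less_Suc)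
  qed
  moreover have "?ii \<Longrightarrow> ?i"
    using width_imp_solves[OF A] by blast
  ultimately show ?thesis
    by blast
qed

end
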